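(* Let $m\ge 9$. Among all graphs in $\mathbb{G}(m,3)$, the graphs $G_{0,3},B_1,B_2,G_{1,3},G_{v,3}$ are the ones with the five largest $Q$-indices, and $$q(G_{0,3})>q(B_1)>q(B_2)>q(G_{1,3})>q(G_{v,3});$$ that is, these inequalities hold and every graph in $\mathbb{G}(m,3)$ not isomorphic to one of these five graphs has $Q$-index smaller than $q(G_{v,3})$.
   Context: All graphs are finite, simple and undirected. For a graph $G$, $Q(G)=D(G)+A(G)$ is its signless Laplacian matrix, and the $Q$-index $q(G)$ is the largest eigenvalue of $Q(G)$. $\mathbb{G}(m,3)$ denotes the family of connected graphs with exactly $m$ edges and girth $3$ (i.e. containing a triangle). Let $C_3=0120$ be a triangle. $G_{0,3}$ is obtained from $C_3$ by attaching $m-3$ pendant edges at vertex $0$; $G_{1,3}$ is obtained from $C_3$ by attaching $m-4$ pendant edges at vertex $0$ and one pendant edge at vertex $1$; $G_{v,3}$ is obtained from $C_3$ by attaching $m-5$ pendant edges at vertex $0$ and a path $0vv_1$ with two new vertices. $B_1$ is obtained from two triangles sharing a common edge (i.e. $K_4$ minus an edge) by attaching $m-5$ pendant edges at one end-vertex of the common edge. $B_2$ is obtained from two triangles sharing a common vertex by attaching $m-6$ pendant edges at that common vertex. All these graphs have $m$ edges. *)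

theory Defs
  imports
    "HOL-Library.Extended_Nat"
    "Graph_Theory.Graph_Theory"
    "Jordan_Normal_Form.Char_Poly"
begin

text \<open>
  A finite simple undirected graph is a \<^locale>\<open>pair_graph\<close> of the AFP entry Graph_Theory: a
  loop-free symmetric digraph without parallel arcs, in which an undirected edge is represented by
  its two arcs.
\<close>

definition edges :: "'a pair_pre_digraph \<Rightarrow> 'a set set" where
  "edges G = {{u, v} |u v. (u, v) \<in> parcs G}"

text \<open>
  In a symmetric digraph, going back and forth along an edge is a \<^const>\<open>pre_digraph.cycle\<close> of
  length 2, hence the bound on the length. The girth of a forest is \<open>\<infinity>\<close>.
\<close>

definition girth :: "'a pair_pre_digraph \<Rightarrow> enat" where
  "girth G = (INF p \<in> {p. pre_digraph.cycle (with_proj G) p \<and> 3 \<le> length p}. enat (length p))"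

definition connected_graphs :: "nat \<Rightarrow> nat \<Rightarrow> 'a pair_pre_digraph set" where
  "connected_graphs m g =
     {G. pair_graph G \<and> Digraph_Component.connected (with_proj G) \<and>
         card (edges G) = m \<and> girth G = enat g}"

definition isomorphic :: "'a pair_pre_digraph \<Rightarrow> 'b pair_pre_digraph \<Rightarrow> bool" where
  "isomorphic G H \<longleftrightarrow> digraph_iso (with_proj G) (with_proj H)"


text \<open>
  Matrices are indexed by \<open>0, \<dots>, n - 1\<close>, so the vertices are listed in an arbitrary order. The
  spectrum does not depend on this order; see \<open>eigenvalue_signless_laplacian_iff\<close> below.
\<close>

definition vertex_list :: "'a pair_pre_digraph \<Rightarrow> 'a list" where
  "vertex_list G = (SOME vs. distinct vs \<and> set vs = pverts G)"

definition adjacency_matrix :: "'a pair_pre_digraph \<Rightarrow> real mat" where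
  "adjacency_matrix G =
     (let vs = vertex_list G; n = length vs
      in mat n n (\<lambda>(i, j). if (vs ! i, vs ! j) \<in> parcs G then 1 else 0))"

definition degree_matrix :: "'a pair_pre_digraph \<Rightarrow> real mat" where
  "degree_matrix G =
     (let vs = vertex_list G; n = length vs
      in mat n n (\<lambda>(i, j). if i = j then real (out_degree (with_proj G) (vs ! i)) else 0))"

definition signless_laplacian :: "'a pair_pre_digraph \<Rightarrow> real mat" where
  "signless_laplacian G = degree_matrix G + adjacency_matrix G"

definition Q_index :: "'a pair_pre_digraph \<Rightarrow> real" where
  "Q_index G = Max {k. eigenvalue (signless_laplacian G) k}"

lemma vertex_list:
  assumes "finite (pverts G)"
  shows "distinct (vertex_list G)" "set (vertex_list G) = pverts G"
proof -
  have "\<exists>vs. distinct vs \<and> set vs = pverts G"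
    using finite_distinct_list[OF assms] by blast
  then have "distinct (vertex_list G) \<and> set (vertex_list G) = pverts G"
    unfolding vertex_list_def by (rule someI_ex)
  then show "distinct (vertex_list G)" "set (vertex_list G) = pverts G" by auto
qed

lemma eigenvalue_signless_laplacian_iff:
  assumes fin: "finite (pverts G)"
  shows "eigenvalue (signless_laplacian G) k \<longleftrightarrow>
    (\<exists>x :: 'a \<Rightarrow> real. (\<exists>v \<in> pverts G. x v \<noteq> 0) \<and>
       (\<forall>u \<in> pverts G. real (out_degree (with_proj G) u) * x u
          + (\<Sum>v | v \<in> pverts G \<and> (u, v) \<in> parcs G. x v) = k * x u))"
proof -
  define vs where "vs = vertex_list G"
  define n where "n = length vs"
  define d where "d = (\<lambda>u. real (out_degree (with_proj G) u))"
  define Q where "Q = signless_laplacian G"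
  have dist: "distinct vs" and set: "set vs = pverts G"
    using vertex_list[OF fin] by (auto simp: vs_def)
  have bij: "bij_betw ((!) vs) {0..<n} (pverts G)"
    using bij_betw_nth[OF dist, of "{0..<n}" "pverts G"] set
    by (simp add: n_def lessThan_atLeast0)
  have Q: "Q = mat n n (\<lambda>(i, j). (if i = j then d (vs ! i) else 0) +
                          (if (vs ! i, vs ! j) \<in> parcs G then 1 else 0))"
    unfolding Q_def signless_laplacian_def degree_matrix_def adjacency_matrix_def Let_def
      vs_def[symmetric] n_def[symmetric] d_def
    by (intro eq_matI) auto
  have mult: "(Q *\<^sub>v vec n (\<lambda>i. x (vs ! i))) $ i =
      d (vs ! i) * x (vs ! i) + (\<Sum>v | v \<in> pverts G \<and> (vs ! i, v) \<in> parcs G. x v)"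
    if i: "i < n" for i and x :: "'a \<Rightarrow> real"
  proof -
    have "(Q *\<^sub>v vec n (\<lambda>i. x (vs ! i))) $ i =
        (\<Sum>j = 0..<n. ((if i = j then d (vs ! i) else 0) +
                   (if (vs ! i, vs ! j) \<in> parcs G then 1 else 0)) * x (vs ! j))"
      using i by (simp add: Q scalar_prod_def)
    also have "\<dots> = (\<Sum>j = 0..<n. if i = j then d (vs ! i) * x (vs ! i) else 0) +
        (\<Sum>j = 0..<n. if (vs ! i, vs ! j) \<in> parcs G then x (vs ! j) else 0)"
      unfolding sum.distrib[symmetric] by (intro sum.cong) (auto simp: algebra_simps)
    also have "(\<Sum>j = 0..<n. if i = j then d (vs ! i) * x (vs ! i) else 0) = d (vs ! i) * x (vs ! i)"
      using i by simp
    also have "(\<Sum>j = 0..<n. if (vs ! i, vs ! j) \<in> parcs G then x (vs ! j) else 0) =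
        (\<Sum>v \<in> pverts G. if (vs ! i, v) \<in> parcs G then x v else 0)"
      by (rule sum.reindex_bij_betw[OF bij])
    also have "\<dots> = (\<Sum>v | v \<in> pverts G \<and> (vs ! i, v) \<in> parcs G. x v)"
      using fin by (simp add: sum.inter_filter)
    finally show ?thesis .
  qed
  have dims: "dim_row Q = n" "dim_col Q = n" by (simp_all add: Q)
  have ev: "eigenvector Q (vec n (\<lambda>i. x (vs ! i))) k \<longleftrightarrow> (\<exists>v \<in> pverts G. x v \<noteq> 0) \<and>
      (\<forall>u \<in> pverts G. d u * x u + (\<Sum>v | v \<in> pverts G \<and> (u, v) \<in> parcs G. x v) = k * x u)"
    for x :: "'a \<Rightarrow> real"
  proof -
    have verts: "pverts G = (!) vs ` {0..<n}" using bij by (simp add: bij_betw_def)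
    have "vec n (\<lambda>i. x (vs ! i)) \<noteq> 0\<^sub>v n \<longleftrightarrow> (\<exists>v \<in> pverts G. x v \<noteq> 0)"
      by (auto simp: verts vec_eq_iff)
    moreover have "Q *\<^sub>v vec n (\<lambda>i. x (vs ! i)) = k \<cdot>\<^sub>v vec n (\<lambda>i. x (vs ! i)) \<longleftrightarrow>
        (\<forall>i < n. (Q *\<^sub>v vec n (\<lambda>i. x (vs ! i))) $ i = k * x (vs ! i))"
      by (auto simp: vec_eq_iff dims)
    moreover have "\<dots> \<longleftrightarrow> (\<forall>u \<in> pverts G.
        d u * x u + (\<Sum>v | v \<in> pverts G \<and> (u, v) \<in> parcs G. x v) = k * x u)"
      using mult by (auto simp: bij_betw_imp_surj_on[OF bij, symmetric] simp del: set_map)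
    ultimately show ?thesis by (simp add: eigenvector_def dims)
  qed
  have "eigenvalue Q k \<longleftrightarrow> (\<exists>x. eigenvector Q (vec n (\<lambda>i. x (vs ! i))) k)"
  proof
    assume "eigenvalue Q k"
    then obtain w where w: "eigenvector Q w k" by (auto simp: eigenvalue_def)
    then have dw: "dim_vec w = n" by (auto simp: eigenvector_def dims)
    have "w = vec n (\<lambda>i. w $ the_inv_into {0..<n} ((!) vs) (vs ! i))"
      using bij dw by (auto simp: vec_eq_iff bij_betw_def the_inv_into_f_f)
    with w show "\<exists>x. eigenvector Q (vec n (\<lambda>i. x (vs ! i))) k"
      by (intro exI[of _ "\<lambda>v. w $ the_inv_into {0..<n} ((!) vs) v"]) simp
  qed (auto simp: eigenvalue_def)
  then show ?thesis unfolding ev unfolding Q_def d_def .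
qed


definition graph_of :: "(nat \<times> nat) set \<Rightarrow> nat pair_pre_digraph" where
  "graph_of E = \<lparr>pverts = Field E, parcs = E \<union> E\<inverse>\<rparr>"

text \<open>
  In each graph below vertex 0 carries the varying number of pendant edges; the product
  \<open>{0} \<times> {a..<b}\<close> attaches \<open>b - a\<close> of them.
\<close>

definition G_0_3 :: "nat \<Rightarrow> nat pair_pre_digraph" where
  "G_0_3 m = graph_of ({(0, 1), (1, 2), (2, 0)} \<union> {0} \<times> {3..<m})"

definition G_1_3 :: "nat \<Rightarrow> nat pair_pre_digraph" where
  "G_1_3 m = graph_of ({(0, 1), (1, 2), (2, 0)} \<union> {(1, 3)} \<union> {0} \<times> {4..<m})"

definition G_v_3 :: "nat \<Rightarrow> nat pair_pre_digraph" where
  "G_v_3 m = graph_of ({(0, 1), (1, 2), (2, 0)} \<union> {(0, 3), (3, 4)} \<union> {0} \<times> {5..<m})"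

definition B_1 :: "nat \<Rightarrow> nat pair_pre_digraph" where
  "B_1 m = graph_of ({(0, 1), (1, 2), (2, 0)} \<union> {(1, 3), (3, 0)} \<union> {0} \<times> {4..<m - 1})"

definition B_2 :: "nat \<Rightarrow> nat pair_pre_digraph" where
  "B_2 m = graph_of ({(0, 1), (1, 2), (2, 0)} \<union> {(0, 3), (3, 4), (4, 0)} \<union> {0} \<times> {5..<m - 1})"

end

theory Submission
  imports Defs "Jordan_Normal_Form.Spectral_Radius"
begin

text \<open>
  A positive weight \<open>w\<close> with \<open>Q w \<le> c w\<close> bounds all eigenvalues of \<open>Q\<close> by \<open>c\<close>. Taking for \<open>w\<close> the
  degrees, and bounding the sum of the degrees of the neighbours of \<open>u\<close> by \<open>2 m - deg u\<close> or, if
  \<open>deg u \<le> 2\<close>, by \<open>(m - 3) deg u\<close>, shows that \<open>Q_index G \<le> m - 1\<close> as soon as all degrees are at most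
  \<open>m - 3\<close>; here \<open>m \<ge> 9\<close> is needed. If some degree is at least \<open>m - 2\<close>, then at most two edges avoid
  that vertex, and a connected graph with a triangle is one of the five exceptional graphs.

  For the exceptional graphs, eliminating all coordinates of a positive eigenvector except the one at
  vertex 0 leaves an equation \<open>q = f q\<close> whose solution is the \<open>Q\<close>-index, and \<open>a < f a\<close> forces a
  solution above \<open>a\<close>. So the chain of inequalities reduces to comparing the functions \<open>f\<close> of
  consecutive graphs, starting from \<open>m - 1 < f (m - 1)\<close> for \<open>G_v_3 m\<close>.
\<close>

section \<open>Eigenvalues of the signless Laplacian\<close>

text \<open>Since \<open>Q_index\<close> is a \<open>Max\<close>, some real eigenvalue has to exist.
  Over the complex numbers the spectrum is nonempty, a real symmetric matrix has only real
  eigenvalues there, and such a value is a root of the real characteristic polynomial too.\<close>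

lemma symmetric_real_mat_eigenvalue:
  fixes A :: "real mat"
  assumes A: "A \<in> carrier_mat n n" and n: "n > 0" and sym: "transpose_mat A = A"
  shows "\<exists>k. eigenvalue A k"
proof -
  define C where "C = map_mat complex_of_real A"
  have C: "C \<in> carrier_mat n n" using A by (simp add: C_def)
  have symC: "transpose_mat C = C" using sym by (simp add: C_def map_mat_transpose)
  obtain l where l: "eigenvalue C l"
    using spectrum_non_empty[OF C n] by (auto simp: spectrum_def)
  then obtain v where v: "v \<in> carrier_vec n" "v \<noteq> 0\<^sub>v n" "C *\<^sub>v v = l \<cdot>\<^sub>v v"
    using C by (auto simp: eigenvalue_def eigenvector_def)
  have "C *\<^sub>v conjugate v = conjugate (C *\<^sub>v v)"
  proof (rule eq_vecI)
    fix i assume "i < dim_vec (conjugate (C *\<^sub>v v))"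
    then show "(C *\<^sub>v conjugate v) $ i = conjugate (C *\<^sub>v v) $ i"
      using A v(1) by (simp add: C_def scalar_prod_def)
  qed simp
  then have Cv: "C *\<^sub>v conjugate v = cnj l \<cdot>\<^sub>v conjugate v"
    by (simp add: v(3) conjugate_smult_vec)
  \<comment> \<open>Moving \<open>C\<close> across the inner product turns the factor
    \<open>l\<close> into \<open>cnj l\<close>; the squared norm of \<open>v\<close> is nonzero and
    cancels.\<close>
  have "l * (v \<bullet> conjugate v) = (transpose_mat C *\<^sub>v v) \<bullet> conjugate v"
    using v by (simp add: symC)
  also have "\<dots> = v \<bullet> (C *\<^sub>v conjugate v)"
    using transpose_vec_mult_scalar[OF C _ v(1)] v(1) by simp
  also have "\<dots> = cnj l * (v \<bullet> conjugate v)" using v by (simp add: Cv)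
  finally have "l = cnj l" using v conjugate_square_eq_0_vec[of v n] by simp
  then have lr: "l = complex_of_real (Re l)" by (metis Reals_cnj_iff of_real_Re)
  have "poly (char_poly C) l = 0" using l eigenvalue_root_char_poly[OF C] by simp
  moreover have "char_poly C = map_poly complex_of_real (char_poly A)"
    unfolding C_def by (rule of_real_hom.char_poly_hom[OF A])
  ultimately have "poly (char_poly A) (Re l) = 0"
    using lr by (metis of_real_eq_0_iff of_real_hom.poly_map_poly)
  then show ?thesis using eigenvalue_root_char_poly[OF A] by blast
qed

abbreviation nbrs :: "'a pair_pre_digraph \<Rightarrow> 'a \<Rightarrow> 'a set" where
  "nbrs G u \<equiv> parcs G `` {u}"

context pair_graph
begin

lemma finite_nbrs: "finite (nbrs G u)"
  by (rule finite_Image[OF pair_finite_arcs])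

lemma nbrs_subset: "nbrs G u \<subseteq> pverts G"
  by (auto dest: in_arcsD2)

lemma out_degree_eq_card_nbrs: "out_degree (with_proj G) u = card (nbrs G u)"
proof -
  have "out_arcs (with_proj G) u = Pair u ` nbrs G u" by (auto simp: out_arcs_def)
  then show ?thesis by (simp add: out_degree_def card_image inj_on_def)
qed

lemma eigenvalue_Q_iff:
  "eigenvalue (signless_laplacian G) k \<longleftrightarrow>
    (\<exists>x. (\<exists>v \<in> pverts G. x v \<noteq> 0) \<and>
       (\<forall>u \<in> pverts G. real (card (nbrs G u)) * x u + (\<Sum>v \<in> nbrs G u. x v) = k * x u))"
proof -
  have "{v. v \<in> pverts G \<and> (u, v) \<in> parcs G} = nbrs G u" for u
    using nbrs_subset by auto
  then show ?thesis
    by (simp add: eigenvalue_signless_laplacian_iff[OF pair_finite_verts] out_degree_eq_card_nbrs)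
qed

text \<open>A Collatz-Wielandt bound: at a vertex \<open>u\<close> where the ratio of the absolute
  value of \<open>x\<close> to \<open>w\<close> is largest, the eigenvalue equation for
  \<open>x\<close> is dominated by the inequality for \<open>w\<close>, scaled by that
  ratio.\<close>

lemma eigenvalue_Q_le:
  assumes w: "\<And>u. u \<in> pverts G \<Longrightarrow> 0 < w u"
    and le: "\<And>u. u \<in> pverts G \<Longrightarrow>
      real (card (nbrs G u)) * w u + (\<Sum>v \<in> nbrs G u. w v) \<le> c * w u"
    and ev: "eigenvalue (signless_laplacian G) k"
  shows "k \<le> c"
proof -
  obtain x z where z: "z \<in> pverts G" "x z \<noteq> 0"
    and x: "\<And>u. u \<in> pverts G \<Longrightarrow>
      real (card (nbrs G u)) * x u + (\<Sum>v \<in> nbrs G u. x v) = k * x u"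
    using ev unfolding eigenvalue_Q_iff by blast
  define r where "r = (\<lambda>v. \<bar>x v\<bar> / w v)"
  have "Max (r ` pverts G) \<in> r ` pverts G"
    using z pair_finite_verts by (intro Max_in) auto
  then obtain u where u: "u \<in> pverts G" "r u = Max (r ` pverts G)" by force
  have max: "r v \<le> r u" if "v \<in> pverts G" for v
    using that u(2) pair_finite_verts by simp
  have abs: "\<bar>x v\<bar> \<le> r u * w v" if "v \<in> pverts G" for v
    using max[OF that] w[OF that] by (simp add: r_def divide_le_eq)
  have xu: "\<bar>x u\<bar> = r u * w u" using w[OF u(1)] by (simp add: r_def)
  \<comment> \<open>The largest ratio is positive because \<open>x\<close> does not vanish at
    \<open>z\<close>; this permits the final cancellation.\<close>
  have "0 < r z" using z w by (simp add: r_def)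
  with max[OF z(1)] have pos: "0 < r u * w u" using w[OF u(1)] by simp
  have "k * \<bar>x u\<bar> \<le> \<bar>k * x u\<bar>" by (simp add: abs_mult mult_right_mono)
  also have "\<dots> \<le> real (card (nbrs G u)) * \<bar>x u\<bar> + (\<Sum>v \<in> nbrs G u. \<bar>x v\<bar>)"
    unfolding x[OF u(1), symmetric]
    by (rule order_trans[OF abs_triangle_ineq add_mono]) (simp_all add: abs_mult sum_abs)
  also have "\<dots> \<le> real (card (nbrs G u)) * (r u * w u) + (\<Sum>v \<in> nbrs G u. r u * w v)"
    using nbrs_subset by (intro add_mono sum_mono) (auto simp: xu intro: abs)
  also have "\<dots> = r u * (real (card (nbrs G u)) * w u + (\<Sum>v \<in> nbrs G u. w v))"
    by (simp add: sum_distrib_left algebra_simps)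
  also have "\<dots> \<le> r u * (c * w u)"
    using le[OF u(1)] pos w[OF u(1)] by (intro mult_left_mono) (auto simp: zero_less_mult_iff)
  finally have "k * (r u * w u) \<le> c * (r u * w u)"
    by (simp add: xu mult.left_commute[of "r u"])
  then show ?thesis using pos by (rule mult_right_le_imp_le)
qed

lemma signless_laplacian_carrier:
  "signless_laplacian G \<in> carrier_mat (card (pverts G)) (card (pverts G))"
proof -
  have "length (vertex_list G) = card (pverts G)"
    using vertex_list[OF pair_finite_verts] by (metis distinct_card)
  then show ?thesis
    by (simp add: signless_laplacian_def degree_matrix_def adjacency_matrix_def Let_def)
qed

lemma transpose_signless_laplacian: "transpose_mat (signless_laplacian G) = signless_laplacian G"
  by (rule eq_matI)
    (auto simp: signless_laplacian_def degree_matrix_def adjacency_matrix_def Let_def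
      dest: arcs_symmetric)

lemma finite_eigenvalues_Q: "finite {k. eigenvalue (signless_laplacian G) k}"
  using card_finite_spectrum(1)[OF signless_laplacian_carrier] by (simp add: spectrum_def)

lemma eigenvalue_Q_index:
  assumes "pverts G \<noteq> {}"
  shows "eigenvalue (signless_laplacian G) (Q_index G)"
proof -
  have "\<exists>k. eigenvalue (signless_laplacian G) k"
    using assms pair_finite_verts
    by (intro symmetric_real_mat_eigenvalue[OF signless_laplacian_carrier])
      (auto simp: transpose_signless_laplacian card_gt_0_iff)
  then have "Max {k. eigenvalue (signless_laplacian G) k} \<in> {k. eigenvalue (signless_laplacian G) k}"
    using finite_eigenvalues_Q by (intro Max_in) auto
  then show ?thesis by (simp add: Q_index_def)
qed

text \<open>The easy half of Perron-Frobenius: a positive eigenvector is at once a witness that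
  \<open>c\<close> is an eigenvalue and a weight for \<open>eigenvalue_Q_le\<close> that bounds all
  others by \<open>c\<close>.\<close>

lemma Q_index_eqI:
  assumes ne: "pverts G \<noteq> {}"
    and w: "\<And>u. u \<in> pverts G \<Longrightarrow> 0 < w u"
    and eq: "\<And>u. u \<in> pverts G \<Longrightarrow>
      real (card (nbrs G u)) * w u + (\<Sum>v \<in> nbrs G u. w v) = c * w u"
  shows "Q_index G = c"
  unfolding Q_index_def
proof (rule Max_eqI[OF finite_eigenvalues_Q])
  show "k \<le> c" if "k \<in> {k. eigenvalue (signless_laplacian G) k}" for k
    using eigenvalue_Q_le[of w c k] w eq that by auto
  have "\<exists>v \<in> pverts G. w v \<noteq> 0" using ne w by force
  then show "c \<in> {k. eigenvalue (signless_laplacian G) k}"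
    using eq by (auto simp: eigenvalue_Q_iff)
qed

section \<open>Counting arcs by edges and by degrees\<close>

text \<open>The map from arcs to edges has fibres of size exactly two, because there are no
  loops.\<close>

lemma card_parcs: "card (parcs G) = 2 * card (edges G)"
proof -
  define e where "e = (\<lambda>(u, v) \<Rightarrow> {u, v :: 'a})"
  have edges: "edges G = e ` parcs G" by (force simp: edges_def e_def)
  have fib: "card {a \<in> parcs G. e a = s} = 2" if s: "s \<in> e ` parcs G" for s
  proof -
    obtain u v where uv: "(u, v) \<in> parcs G" "s = {u, v}" using s by (force simp: e_def)
    then have "{a \<in> parcs G. e a = s} = {(u, v), (v, u)}"
      using arcs_symmetric by (auto simp: e_def doubleton_eq_iff)
    moreover have "u \<noteq> v" using uv no_loops' by auto
    ultimately show ?thesis by simp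
  qed
  have "(\<Sum>s \<in> e ` parcs G. \<Sum>a | a \<in> parcs G \<and> e a = s. 1) = (\<Sum>a \<in> parcs G. 1 :: nat)"
    by (rule sum.image_gen[OF pair_finite_arcs, symmetric])
  then have "card (parcs G) = (\<Sum>s \<in> e ` parcs G. card {a \<in> parcs G. e a = s})" by simp
  also have "\<dots> = 2 * card (edges G)" using fib by (simp add: edges)
  finally show ?thesis .
qed

lemma sum_card_nbrs: "(\<Sum>u \<in> pverts G. card (nbrs G u)) = card (parcs G)"
proof -
  have "parcs G = Sigma (pverts G) (nbrs G)" by (auto dest: in_arcsD1)
  then show ?thesis
    by (metis card_SigmaI pair_finite_verts finite_nbrs)
qed

text \<open>The vertex \<open>u\<close> and its neighbours are distinct vertices, so their degrees
  form part of the total degree.\<close>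

lemma sum_card_nbrs_nbrs:
  assumes "u \<in> pverts G"
  shows "(\<Sum>v \<in> nbrs G u. card (nbrs G v)) + card (nbrs G u) \<le> 2 * card (edges G)"
proof -
  have "u \<notin> nbrs G u" using no_loops' by auto
  then have "(\<Sum>v \<in> nbrs G u. card (nbrs G v)) + card (nbrs G u) =
      (\<Sum>v \<in> insert u (nbrs G u). card (nbrs G v))"
    by (simp add: finite_nbrs)
  also have "\<dots> \<le> (\<Sum>u \<in> pverts G. card (nbrs G u))"
    using assms nbrs_subset by (intro sum_mono2 pair_finite_verts) auto
  finally show ?thesis by (simp add: sum_card_nbrs card_parcs)
qed

text \<open>With the degrees as weights, the condition at a vertex of degree \<open>d\<close> reads
  \<open>d^2 + s <= (m - 1) d\<close>, where \<open>s\<close> is the sum of the degrees of its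
  neighbours.\<close>

lemma Q_index_le_if_degree_le:
  assumes m: "9 \<le> card (edges G)" and ne: "pverts G \<noteq> {}"
    and pos: "\<And>u. u \<in> pverts G \<Longrightarrow> nbrs G u \<noteq> {}"
    and max: "\<And>u. u \<in> pverts G \<Longrightarrow> card (nbrs G u) + 3 \<le> card (edges G)"
  shows "Q_index G \<le> real (card (edges G)) - 1"
proof (rule eigenvalue_Q_le[OF _ _ eigenvalue_Q_index[OF ne]])
  define m where "m = card (edges G)"
  fix u assume u: "u \<in> pverts G"
  define d where "d = card (nbrs G u)"
  define s where "s = (\<Sum>v \<in> nbrs G u. card (nbrs G v))"
  have d: "0 < d" using pos[OF u] finite_nbrs by (simp add: d_def card_gt_0_iff)
  then show "0 < real (card (nbrs G u))" by (simp add: d_def)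
  have d3: "d + 3 \<le> m" and m9: "9 \<le> m" using max[OF u] m by (simp_all add: d_def m_def)
  have "real d * real d + real s \<le> (real m - 1) * real d"
  proof (cases "d \<le> 2")
    case True
    have "s \<le> (\<Sum>v \<in> nbrs G u. m - 3)"
      unfolding s_def using max nbrs_subset by (intro sum_mono) (fastforce simp: m_def)
    then have "s \<le> d * (m - 3)" by (simp add: d_def)
    then have "real s \<le> real (d * (m - 3))" by (rule of_nat_mono)
    also have "\<dots> = real d * (real m - 3)" using m9 by (simp add: of_nat_diff)
    finally have "real s \<le> real d * (real m - 3)" .
    \<comment> \<open>Given \<open>s <= d (m - 3)\<close>, this is exactly what remains of the
      condition.\<close>
    moreover have "real d * (real d - 2) \<le> 0" using True by (simp add: mult_le_0_iff)
    ultimately show ?thesis by (simp add: algebra_simps)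
  next
    case False
    have "real (s + d) \<le> real (2 * m)"
      using sum_card_nbrs_nbrs[OF u] unfolding s_def d_def m_def by (rule of_nat_mono)
    then have "real s + real d \<le> 2 * real m" by simp
    \<comment> \<open>Both factors are nonnegative for \<open>3 <= d <= m - 3\<close>. Expanded,
      this says \<open>m d - d^2 >= 3 m - 9\<close>, and \<open>3 m - 9 >= 2 m\<close> holds from
      \<open>m = 9\<close> on; with \<open>s <= 2 m - d\<close> the condition follows.\<close>
    moreover have "0 \<le> (real d - 3) * (real m - 3 - real d)"
      using False d3 by (intro mult_nonneg_nonneg) linarith+
    moreover have "(real d - 3) * (real m - 3 - real d) =
        (real m - 1) * real d - real d * real d + real d - 3 * real m + 9"
      by (simp add: algebra_simps)
    moreover have "9 \<le> real m" using m9 by simp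
    ultimately show ?thesis by linarith
  qed
  then show "real (card (nbrs G u)) * real (card (nbrs G u)) + (\<Sum>v \<in> nbrs G u. real (card (nbrs G v)))
      \<le> (real (card (edges G)) - 1) * real (card (nbrs G u))"
    by (simp add: s_def d_def m_def)
qed

end

section \<open>Adding pendant vertices at a vertex of a fixed graph\<close>

context pair_graph
begin

text \<open>The arc set is already symmetric, so the symmetric closure in the definition of
  connectedness changes nothing and strong connectedness is meant.\<close>

lemma connected_iff:
  "Digraph_Component.connected (with_proj G) \<longleftrightarrow>
    pverts G \<noteq> {} \<and> (\<forall>u \<in> pverts G. \<forall>v \<in> pverts G. (u, v) \<in> (parcs G)\<^sup>*)"
proof -
  have "mk_symmetric (with_proj G) = G"
    by (rule pair_pre_digraph.equality) (auto simp: parcs_mk_symmetric intro: arcs_symmetric)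
  then show ?thesis
    by (auto simp: Digraph_Component.connected_def strongly_connected_def reachable_conv')
qed

text \<open>An infimum of extended naturals different from infinity is attained, so girth 3 yields a
  cycle of length 3. Conversely a triangle attains the lower bound 3 built into
  \<open>girth\<close>.\<close>

lemma girth_eq_3_iff:
  "girth G = enat 3 \<longleftrightarrow> (\<exists>a b c. (a, b) \<in> parcs G \<and> (b, c) \<in> parcs G \<and> (c, a) \<in> parcs G)"
proof
  let ?S = "(\<lambda>p. enat (length p)) ` {p. cycle p \<and> 3 \<le> length p}"
  assume "girth G = enat 3"
  then have inf: "Inf ?S = enat 3" by (simp add: girth_def)
  have "?S \<noteq> {}"
  proof
    assume "?S = {}"
    then have "Inf ?S = \<infinity>" by (simp only: Inf_enat_def simp_thms if_True)
    with inf show False by simp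
  qed
  then have "Inf ?S \<in> ?S" unfolding Inf_enat_def by (auto intro: LeastI)
  then obtain p where "cycle p" "length p = 3" unfolding inf by auto
  then obtain e f g u where "p = [e, f, g]" "awalk u p u"
    by (auto simp: cycle_def length_Suc_conv numeral_3_eq_3)
  then have "(u, fst f) \<in> parcs G" "(fst f, fst g) \<in> parcs G" "(fst g, u) \<in> parcs G"
    by (auto simp: awalk_def) (metis prod.collapse)+
  then show "\<exists>a b c. (a, b) \<in> parcs G \<and> (b, c) \<in> parcs G \<and> (c, a) \<in> parcs G" by blast
next
  assume "\<exists>a b c. (a, b) \<in> parcs G \<and> (b, c) \<in> parcs G \<and> (c, a) \<in> parcs G"
  then obtain a b c where abc: "(a, b) \<in> parcs G" "(b, c) \<in> parcs G" "(c, a) \<in> parcs G" by blast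
  then have "cycle [(a, b), (b, c), (c, a)]"
    unfolding cycle_def by (intro exI[of _ a]) (auto simp: awalk_def dest: in_arcsD1 no_loops')
  then show "girth G = enat 3"
    unfolding girth_def by (intro antisym INF_lower2[of "[(a, b), (b, c), (c, a)]"] INF_greatest) auto
qed

end

text \<open>A common shape for the five graphs: a kernel \<open>K\<close> on the vertices below
  \<open>k\<close>, with the vertices from \<open>k\<close> to \<open>n - 1\<close> pendant at 0.
  \<open>K\<close> holds one arc per edge; \<open>antisym_K\<close> says this and excludes loops as
  well. The graph has \<open>n\<close> vertices.\<close>

locale star_extension =
  fixes K :: "(nat \<times> nat) set" and k n :: nat
  assumes Field_K: "Field K = {..<k}" and antisym_K: "K \<inter> K\<inverse> = {}"
    and k_pos: "0 < k" and k_le_n: "k \<le> n"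
begin

abbreviation H :: "nat pair_pre_digraph" where
  "H \<equiv> graph_of (K \<union> {0} \<times> {k..<n})"

abbreviation N :: "nat \<Rightarrow> nat set" where
  "N i \<equiv> (K \<union> K\<inverse>) `` {i}"

lemma pverts_H: "pverts H = {..<n}"
  using k_pos k_le_n by (auto simp: graph_of_def Field_K) (auto simp: Field_def)

lemma parcs_H: "parcs H = K \<union> K\<inverse> \<union> {0} \<times> {k..<n} \<union> {k..<n} \<times> {0}"
  by (auto simp: graph_of_def)

lemma K_less: "(i, j) \<in> K \<Longrightarrow> i < k \<and> j < k"
  using Field_K by (auto simp: Field_def)

lemma finite_K: "finite K"
  by (rule finite_subset[of _ "{..<k} \<times> {..<k}"]) (auto dest: K_less)

lemma N_less: "N i \<subseteq> {..<k}"
  by (auto dest: K_less)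

lemma finite_N: "finite (N i)"
  using N_less finite_subset by blast

lemma nbrs_0: "nbrs H 0 = N 0 \<union> {k..<n}"
  using k_pos by (auto simp: parcs_H)

lemma nbrs_kernel: "0 < i \<Longrightarrow> i < k \<Longrightarrow> nbrs H i = N i"
  by (auto simp: parcs_H)

lemma nbrs_pendant: "k \<le> i \<Longrightarrow> i < n \<Longrightarrow> nbrs H i = {0}"
  using k_pos by (auto simp: parcs_H dest: K_less)

sublocale graph_H: pair_graph H
proof
  show "finite (pverts H)" by (simp add: pverts_H)
  show "finite (parcs H)" using finite_K by (simp add: parcs_H)
  show "symmetric (with_proj H)" by (auto simp: symmetric_def parcs_H intro: symI)
  show "fst e \<noteq> snd e" if "e \<in> parcs H" for e
    using that antisym_K k_pos by (cases e) (auto simp: parcs_H)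
  show "fst e \<in> pverts H" "snd e \<in> pverts H" if "e \<in> parcs H" for e
    using that k_pos k_le_n by (cases e, force simp: parcs_H pverts_H dest: K_less)+
qed

text \<open>The chosen orientation and its converse are disjoint, so the arcs are twice as many as
  the oriented edges, just as they are twice the edges.\<close>

lemma card_edges_H: "card (edges H) = card K + (n - k)"
proof -
  let ?E = "K \<union> {0} \<times> {k..<n}"
  have "card ?E = card K + (n - k)"
    by (subst card_Un_disjoint) (auto simp: finite_K card_cartesian_product dest: K_less)
  moreover have "parcs H = ?E \<union> ?E\<inverse>" by (simp add: graph_of_def)
  moreover have "?E \<inter> ?E\<inverse> = {}" using antisym_K k_pos by (auto dest: K_less)
  ultimately have "card (parcs H) = 2 * (card K + (n - k))"
    using finite_K by (simp add: card_Un_disjoint)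
  then show ?thesis by (simp add: graph_H.card_parcs)
qed

text \<open>Pendant vertices are one arc away from 0, so only the kernel vertices need a path from
  0; by symmetry any two vertices are joined through 0.\<close>

lemma H_in_connected_graphs:
  assumes reach: "\<And>i. i < k \<Longrightarrow> (0, i) \<in> (K \<union> K\<inverse>)\<^sup>*"
    and triangle: "(0, 1) \<in> K" "(1, 2) \<in> K" "(2, 0) \<in> K"
  shows "H \<in> connected_graphs (card K + (n - k)) 3"
proof -
  have "(0, i) \<in> (parcs H)\<^sup>*" if "i < n" for i
  proof (cases "i < k")
    case True
    moreover have "(K \<union> K\<inverse>)\<^sup>* \<subseteq> (parcs H)\<^sup>*" by (intro rtrancl_mono) (auto simp: parcs_H)
    ultimately show ?thesis using reach by auto
  next
    case False
    then show ?thesis using that by (intro r_into_rtrancl) (auto simp: parcs_H)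
  qed
  moreover have "sym ((parcs H)\<^sup>*)" by (intro sym_rtrancl) (auto simp: parcs_H intro: symI)
  moreover have "0 \<in> {..<n}" using k_pos k_le_n by simp
  ultimately have "Digraph_Component.connected (with_proj H)"
    unfolding graph_H.connected_iff pverts_H
    by (metis empty_iff lessThan_iff rtrancl_trans symD)
  moreover have "girth H = enat 3"
    unfolding graph_H.girth_eq_3_iff using triangle by (auto simp: parcs_H)
  ultimately show ?thesis
    by (simp add: connected_graphs_def card_edges_H graph_H.pair_graph)
qed

text \<open>
  The equation below is the eigenvalue equation at vertex 0 for an eigenvector normalised to 1 there;
  the other equations are solved by \<open>g q\<close> on the vertices of \<open>K\<close> and by \<open>1 / (q - 1)\<close> on the pendant
  vertices.
\<close>

lemma Q_index_secular:
  fixes g :: "real \<Rightarrow> nat \<Rightarrow> real"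
  defines "f \<equiv> \<lambda>q. real (card (N 0) + (n - k)) + real (n - k) / (q - 1) + (\<Sum>v \<in> N 0. g q v)"
  assumes a: "2 \<le> a"
    and g0: "\<And>q. g q 0 = 1"
    and pos: "\<And>q i. a \<le> q \<Longrightarrow> i < k \<Longrightarrow> 0 < g q i \<and> g q i \<le> 1"
    and cont: "\<And>i. i < k \<Longrightarrow> continuous_on {a..} (\<lambda>q. g q i)"
    and eq: "\<And>q i. a \<le> q \<Longrightarrow> 0 < i \<Longrightarrow> i < k \<Longrightarrow>
      real (card (N i)) * g q i + (\<Sum>v \<in> N i. g q v) = q * g q i"
    and less: "a < f a"
  shows "\<exists>r > a. r = f r \<and> Q_index H = r"
proof -
  \<comment> \<open>A right end point with \<open>f b <= b\<close>: for \<open>q >= a\<close> the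
    values of \<open>g\<close> are at most 1 and \<open>1 / (q - 1) <= 1\<close>, so the second
    summand bounds \<open>f b\<close>.\<close>
  define b where "b = f a + 2 * real (card (N 0) + (n - k))"
  have ab: "a < b" using less by (simp add: b_def)
  have le: "f b \<le> 2 * real (card (N 0) + (n - k))"
  proof -
    have "(\<Sum>v \<in> N 0. g b v) \<le> (\<Sum>v \<in> N 0. 1)"
      using pos ab N_less by (intro sum_mono) (auto simp: subset_iff)
    moreover have "real (n - k) / (b - 1) \<le> real (n - k)"
      using a ab by (simp add: divide_le_eq mult_le_cancel_left1)
    ultimately show ?thesis by (simp add: f_def)
  qed
  have cont_sum: "continuous_on {a..b} (\<lambda>q. \<Sum>v \<in> N 0. g q v)"
    using N_less by (intro continuous_on_sum continuous_on_subset[OF cont]) auto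
  have "continuous_on {a..b} (\<lambda>q. q - f q)"
    unfolding f_def using a by (intro cont_sum continuous_intros) auto
  moreover have "0 \<le> b - f b" using le less a by (simp add: b_def)
  \<comment> \<open>The function \<open>q - f q\<close> is negative at \<open>a\<close> and
    nonnegative at \<open>b\<close>; the strict inequality at \<open>a\<close> also gives
    \<open>a < r\<close>.\<close>
  ultimately obtain r where r: "a \<le> r" "r - f r = 0"
    using IVT'[of "\<lambda>q. q - f q" a 0 b] less ab by auto
  with less have ar: "a < r" by (cases "r = a") auto
  \<comment> \<open>This is a positive eigenvector for \<open>r\<close>; at vertex 0 its equation is
    \<open>r = f r\<close>, elsewhere it holds by the choice of \<open>g\<close> and of
    \<open>1 / (r - 1)\<close>.\<close>
  define w where "w = (\<lambda>i. if i < k then g r i else 1 / (r - 1))"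
  have wN: "(\<Sum>v \<in> N i. w v) = (\<Sum>v \<in> N i. g r v)" for i
    using N_less by (intro sum.cong) (auto simp: w_def subset_iff)
  have "Q_index H = r"
  proof (rule graph_H.Q_index_eqI)
    show "pverts H \<noteq> {}" using k_pos k_le_n by (simp add: pverts_H lessThan_empty_iff)
    show "0 < w u" for u using pos ar a by (simp add: w_def)
    fix u assume u: "u \<in> pverts H"
    consider "u = 0" | "0 < u" "u < k" | "k \<le> u" "u < n"
      using u by (metis lessThan_iff neq0_conv not_less pverts_H)
    then show "real (card (nbrs H u)) * w u + (\<Sum>v \<in> nbrs H u. w v) = r * w u"
    proof cases
      case 1
      have disj: "N 0 \<inter> {k..<n} = {}" using N_less by (force simp: subset_iff)
      have "(\<Sum>v \<in> {k..<n}. w v) = real (n - k) / (r - 1)" by (simp add: w_def)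
      then show ?thesis
        using 1 k_pos disj finite_N wN[of 0] r(2)
        by (simp add: nbrs_0 card_Un_disjoint sum.union_disjoint f_def w_def g0)
    next
      case 2
      then show ?thesis using eq[of r u] ar wN by (simp add: nbrs_kernel) (simp add: w_def)
    next
      case 3
      then show ?thesis using a ar k_pos by (simp add: nbrs_pendant w_def g0 field_simps)
    qed
  qed
  with ar r(2) show ?thesis by auto
qed

end

section \<open>The five graphs\<close>

lemma less_3_iff: "i < 3 \<longleftrightarrow> i = 0 \<or> i = 1 \<or> i = 2" for i :: nat by auto
lemma less_4_iff: "i < 4 \<longleftrightarrow> i = 0 \<or> i = 1 \<or> i = 2 \<or> i = 3" for i :: nat by auto
lemma less_5_iff: "i < 5 \<longleftrightarrow> i = 0 \<or> i = 1 \<or> i = 2 \<or> i = 3 \<or> i = 4" for i :: nat by auto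

abbreviation base_triangle :: "(nat \<times> nat) set" where
  "base_triangle \<equiv> {(0, 1), (1, 2), (2, 0)}"

lemma star_extension_G_0_3: "3 \<le> n \<Longrightarrow> star_extension base_triangle 3 n"
  by unfold_locales (auto simp: Field_def less_3_iff)

lemma star_extension_G_1_3: "4 \<le> n \<Longrightarrow> star_extension (base_triangle \<union> {(1, 3)}) 4 n"
  by unfold_locales (auto simp: Field_def less_4_iff)

lemma star_extension_G_v_3: "5 \<le> n \<Longrightarrow> star_extension (base_triangle \<union> {(0, 3), (3, 4)}) 5 n"
  by unfold_locales (auto simp: Field_def less_5_iff)

lemma star_extension_B_1: "4 \<le> n \<Longrightarrow> star_extension (base_triangle \<union> {(1, 3), (3, 0)}) 4 n"
  by unfold_locales (auto simp: Field_def less_4_iff)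

lemma star_extension_B_2: "5 \<le> n \<Longrightarrow> star_extension (base_triangle \<union> {(0, 3), (3, 4), (4, 0)}) 5 n"
  by unfold_locales (auto simp: Field_def less_5_iff)

section \<open>Membership of the five graphs in the family\<close>

lemma G_0_3_in_connected_graphs:
  assumes "3 \<le> m"
  shows "G_0_3 m \<in> connected_graphs m 3"
proof -
  let ?K = base_triangle
  interpret star_extension ?K 3 m by (rule star_extension_G_0_3) fact
  have "H \<in> connected_graphs (card ?K + (m - 3)) 3"
    by (rule H_in_connected_graphs) (auto simp: less_3_iff)
  moreover have "card ?K + (m - 3) = m" using assms by simp
  ultimately show ?thesis by (simp only: G_0_3_def)
qed

lemma G_1_3_in_connected_graphs:
  assumes "4 \<le> m"
  shows "G_1_3 m \<in> connected_graphs m 3"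
proof -
  let ?K = "base_triangle \<union> {(1, 3)}"
  interpret star_extension ?K 4 m by (rule star_extension_G_1_3) fact
  have "(0, 3) \<in> (?K \<union> ?K\<inverse>)\<^sup>*" by (rule rtrancl_into_rtrancl[of _ 1]) auto
  then have "H \<in> connected_graphs (card ?K + (m - 4)) 3"
    by (intro H_in_connected_graphs) (auto simp: less_4_iff)
  moreover have "card ?K + (m - 4) = m" using assms by simp
  ultimately show ?thesis by (simp only: G_1_3_def)
qed

lemma G_v_3_in_connected_graphs:
  assumes "5 \<le> m"
  shows "G_v_3 m \<in> connected_graphs m 3"
proof -
  let ?K = "base_triangle \<union> {(0, 3), (3, 4)}"
  interpret star_extension ?K 5 m by (rule star_extension_G_v_3) fact
  have "(0, 4) \<in> (?K \<union> ?K\<inverse>)\<^sup>*" by (rule rtrancl_into_rtrancl[of _ 3]) auto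
  then have "H \<in> connected_graphs (card ?K + (m - 5)) 3"
    by (intro H_in_connected_graphs) (auto simp: less_5_iff)
  moreover have "card ?K + (m - 5) = m" using assms by simp
  ultimately show ?thesis by (simp only: G_v_3_def)
qed

lemma B_1_in_connected_graphs:
  assumes "5 \<le> m"
  shows "B_1 m \<in> connected_graphs m 3"
proof -
  let ?K = "base_triangle \<union> {(1, 3), (3, 0)}"
  \<comment> \<open>The kernel has one edge more than it has vertices, so \<open>m\<close> edges
    need only \<open>m - 1\<close> vertices.\<close>
  interpret star_extension ?K 4 "m - 1" using assms by (intro star_extension_B_1) simp
  have "H \<in> connected_graphs (card ?K + (m - 1 - 4)) 3"
    by (intro H_in_connected_graphs) (auto simp: less_4_iff)
  moreover have "card ?K + (m - 1 - 4) = m" using assms by simp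
  ultimately show ?thesis by (simp only: B_1_def)
qed

lemma B_2_in_connected_graphs:
  assumes "6 \<le> m"
  shows "B_2 m \<in> connected_graphs m 3"
proof -
  let ?K = "base_triangle \<union> {(0, 3), (3, 4), (4, 0)}"
  interpret star_extension ?K 5 "m - 1" using assms by (intro star_extension_B_2) simp
  have "H \<in> connected_graphs (card ?K + (m - 1 - 5)) 3"
    by (intro H_in_connected_graphs) (auto simp: less_5_iff)
  moreover have "card ?K + (m - 1 - 5) = m" using assms by simp
  ultimately show ?thesis by (simp only: B_2_def)
qed

section \<open>The secular equations of the five graphs\<close>

text \<open>By symmetry the vertices 1 and 2 share a value \<open>y\<close>, and
  \<open>(q - 2) y = 1 + y\<close> gives \<open>y = 1 / (q - 3)\<close>. The constant term of
  \<open>f\<close> is the degree of vertex 0, as in the four lemmas that follow.\<close>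

lemma Q_index_G_0_3:
  fixes m :: nat
  defines "f \<equiv> \<lambda>q. (real m - 1) + (real m - 3) / (q - 1) + 2 / (q - 3)"
  assumes m: "3 \<le> m" and a: "8 \<le> a" and less: "a < f a"
  shows "\<exists>r > a. r = f r \<and> Q_index (G_0_3 m) = r"
proof -
  let ?K = base_triangle
  interpret star_extension ?K 3 m by (rule star_extension_G_0_3) fact
  define g where "g = (\<lambda>q :: real. (!) [1, 1 / (q - 3), 1 / (q - 3)])"
  have N: "N 0 = {1, 2}" "N 1 = {0, 2}" "N 2 = {0, 1}" by auto
  have f: "real (card (N 0) + (m - 3)) + real (m - 3) / (q - 1) + (\<Sum>v \<in> N 0. g q v) = f q" for q
    unfolding N using m by (simp add: g_def f_def of_nat_diff)
  have "\<exists>r > a. r = real (card (N 0) + (m - 3)) + real (m - 3) / (r - 1) + (\<Sum>v \<in> N 0. g r v)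
      \<and> Q_index H = r"
  proof (rule Q_index_secular)
    show "continuous_on {a..} (\<lambda>q. g q i)" if "i < 3" for i
      using that a unfolding less_3_iff g_def by (elim disjE) (auto intro!: continuous_intros)
    fix q assume q: "a \<le> q"
    define y where "y = 1 / (q - 3)"
    have gq: "g q = (!) [1, y, y]" by (simp add: g_def y_def)
    have y: "0 < y" "y \<le> 1" "q * y = 3 * y + 1"
      using q a by (simp_all add: y_def divide_simps)
    show "0 < g q i \<and> g q i \<le> 1" if "i < 3" for i
      using that y unfolding less_3_iff gq by (elim disjE) auto
    show "real (card (N i)) * g q i + (\<Sum>v \<in> N i. g q v) = q * g q i" if "0 < i" "i < 3" for i
    proof -
      have "i = 1 \<or> i = 2" using that by auto
      then show ?thesis by (elim disjE; simp only: N gq) (simp_all add: y)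
    qed
  qed (use a less in \<open>simp_all only: f\<close>, simp_all add: g_def)
  then show ?thesis unfolding f by (simp only: G_0_3_def)
qed

text \<open>Vertices 2 and 3 share a value \<open>y\<close>. Together with the value
  \<open>x\<close> at 1 it solves \<open>(q - 3) x = 1 + 2 y\<close> and
  \<open>(q - 2) y = 1 + x\<close>, a system of determinant \<open>(q - 1) (q - 4)\<close>.\<close>

lemma Q_index_B_1:
  fixes m :: nat
  defines "f \<equiv> \<lambda>q. (real m - 2) + (real m - 5) / (q - 1) + (3 * q - 4) / ((q - 1) * (q - 4))"
  assumes m: "5 \<le> m" and a: "8 \<le> a" and less: "a < f a"
  shows "\<exists>r > a. r = f r \<and> Q_index (B_1 m) = r"
proof -
  let ?K = "base_triangle \<union> {(1, 3), (3, 0)}"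
  interpret star_extension ?K 4 "m - 1" using m by (intro star_extension_B_1) simp
  define g where "g = (\<lambda>q :: real. (!) [1, q / ((q - 1) * (q - 4)),
      (q - 2) / ((q - 1) * (q - 4)), (q - 2) / ((q - 1) * (q - 4))])"
  have N: "N 0 = {1, 2, 3}" "N 1 = {0, 2, 3}" "N 2 = {0, 1}" "N 3 = {0, 1}" by auto
  have f: "real (card (N 0) + (m - 1 - 4)) + real (m - 1 - 4) / (q - 1) + (\<Sum>v \<in> N 0. g q v) = f q" for q
    unfolding N using m by (simp add: g_def f_def of_nat_diff add_divide_distrib[symmetric])
  have "\<exists>r > a. r = real (card (N 0) + (m - 1 - 4)) + real (m - 1 - 4) / (r - 1) + (\<Sum>v \<in> N 0. g r v)
      \<and> Q_index H = r"
  proof (rule Q_index_secular)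
    show "continuous_on {a..} (\<lambda>q. g q i)" if "i < 4" for i
      using that a unfolding less_4_iff g_def by (elim disjE) (auto intro!: continuous_intros)
    fix q assume q: "a \<le> q"
    define p where "p = (q - 1) * (q - 4)"
    define x y where "x = q / p" and "y = (q - 2) / p"
    have gq: "g q = (!) [1, x, y, y]" by (simp add: g_def p_def x_def y_def)
    \<comment> \<open>These estimates give \<open>0 < p\<close> and \<open>q <= p\<close>, hence
      values between 0 and 1.\<close>
    have "7 * 4 \<le> (q - 1) * (q - 4)" using q a by (intro mult_mono) auto
    moreover have "q \<le> q * (q - 7)" using q a by (simp add: mult_le_cancel_left1)
    ultimately have p: "0 < p" "q \<le> p" by (simp_all add: p_def algebra_simps)
    then have y: "0 < x" "x \<le> 1" "0 < y" "y \<le> 1"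
      using q a by (simp_all add: x_def y_def divide_simps)
    have eq: "q * x = 3 * x + 1 + 2 * y" "q * y = 2 * y + 1 + x"
      using p(1) by (simp_all add: x_def y_def divide_simps) (simp_all add: p_def algebra_simps)
    show "0 < g q i \<and> g q i \<le> 1" if "i < 4" for i
      using that y unfolding less_4_iff gq by (elim disjE) auto
    show "real (card (N i)) * g q i + (\<Sum>v \<in> N i. g q v) = q * g q i" if "0 < i" "i < 4" for i
    proof -
      have "i = 1 \<or> i = 2 \<or> i = 3" using that by auto
      then show ?thesis by (elim disjE; simp only: N gq) (simp_all add: eq)
    qed
  qed (use a less in \<open>simp_all only: f\<close>, simp_all add: g_def)
  then show ?thesis unfolding f by (simp only: B_1_def)
qed

text \<open>Each triangle contributes two vertices of value \<open>1 / (q - 3)\<close>, as for a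
  single triangle.\<close>

lemma Q_index_B_2:
  fixes m :: nat
  defines "f \<equiv> \<lambda>q. (real m - 2) + (real m - 6) / (q - 1) + 4 / (q - 3)"
  assumes m: "6 \<le> m" and a: "8 \<le> a" and less: "a < f a"
  shows "\<exists>r > a. r = f r \<and> Q_index (B_2 m) = r"
proof -
  let ?K = "base_triangle \<union> {(0, 3), (3, 4), (4, 0)}"
  interpret star_extension ?K 5 "m - 1" using m by (intro star_extension_B_2) simp
  define g where "g = (\<lambda>q :: real. (!) [1, 1 / (q - 3), 1 / (q - 3), 1 / (q - 3), 1 / (q - 3)])"
  have N: "N 0 = {1, 2, 3, 4}" "N 1 = {0, 2}" "N 2 = {0, 1}" "N 3 = {0, 4}" "N 4 = {0, 3}" by auto
  have f: "real (card (N 0) + (m - 1 - 5)) + real (m - 1 - 5) / (q - 1) + (\<Sum>v \<in> N 0. g q v) = f q" for q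
    unfolding N using m by (simp add: g_def f_def of_nat_diff)
  have "\<exists>r > a. r = real (card (N 0) + (m - 1 - 5)) + real (m - 1 - 5) / (r - 1) + (\<Sum>v \<in> N 0. g r v)
      \<and> Q_index H = r"
  proof (rule Q_index_secular)
    show "continuous_on {a..} (\<lambda>q. g q i)" if "i < 5" for i
      using that a unfolding less_5_iff g_def by (elim disjE) (auto intro!: continuous_intros)
    fix q assume q: "a \<le> q"
    define y where "y = 1 / (q - 3)"
    have gq: "g q = (!) [1, y, y, y, y]" by (simp add: g_def y_def)
    have y: "0 < y" "y \<le> 1" "q * y = 3 * y + 1"
      using q a by (simp_all add: y_def divide_simps)
    show "0 < g q i \<and> g q i \<le> 1" if "i < 5" for i
      using that y unfolding less_5_iff gq by (elim disjE) auto
    show "real (card (N i)) * g q i + (\<Sum>v \<in> N i. g q v) = q * g q i" if "0 < i" "i < 5" for i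
    proof -
      have "i = 1 \<or> i = 2 \<or> i = 3 \<or> i = 4" using that by auto
      then show ?thesis by (elim disjE; simp only: N gq) (simp_all add: y)
    qed
  qed (use a less in \<open>simp_all only: f\<close>, simp_all add: g_def)
  then show ?thesis unfolding f by (simp only: B_2_def)
qed

text \<open>Eliminating \<open>z = x / (q - 1)\<close> at the pendant vertex 3 and
  \<open>y = (1 + x) / (q - 2)\<close> at vertex 2 from \<open>(q - 3) x = 1 + y + z\<close> at
  vertex 1 leaves \<open>x = (q - 1)^2 / P q\<close>, with \<open>P\<close> the cubic
  denominator.\<close>

lemma Q_index_G_1_3:
  fixes m :: nat
  defines "f \<equiv> \<lambda>q. (real m - 2) + (real m - 4) / (q - 1)
      + (2 * q^2 - 5 * q + 2) / (q^3 - 6 * q^2 + 9 * q - 3)"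
  assumes m: "4 \<le> m" and a: "8 \<le> a" and less: "a < f a"
  shows "\<exists>r > a. r = f r \<and> Q_index (G_1_3 m) = r"
proof -
  let ?K = "base_triangle \<union> {(1, 3)}"
  interpret star_extension ?K 4 m by (rule star_extension_G_1_3) fact
  define P where "P = (\<lambda>q :: real. q^3 - 6 * q^2 + 9 * q - 3)"
  have P: "q^2 \<le> P q" "0 < P q" "q \<le> q^2" if "8 \<le> q" for q
  proof -
    have "P q = q^2 + (q^2 * (q - 8) + q^2 + 9 * q - 3)"
      by (simp add: P_def power2_eq_square power3_eq_cube algebra_simps)
    moreover have "0 \<le> q^2 * (q - 8)" "0 \<le> q^2" using that by auto
    ultimately show "q^2 \<le> P q" using that by linarith
    then show "0 < P q" using that by (smt (verit) zero_less_power)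
    show "q \<le> q^2" using that by (simp add: power2_eq_square)
  qed
  define g where "g = (\<lambda>q :: real. (!) [1, (q - 1)^2 / P q, (q^2 - 3 * q + 1) / P q, (q - 1) / P q])"
  have N: "N 0 = {1, 2}" "N 1 = {0, 2, 3}" "N 2 = {0, 1}" "N 3 = {1}" by auto
  have f: "real (card (N 0) + (m - 4)) + real (m - 4) / (q - 1) + (\<Sum>v \<in> N 0. g q v) = f q" for q
    unfolding N using m
    by (simp add: g_def f_def of_nat_diff P_def add_divide_distrib[symmetric])
      (simp add: power2_eq_square algebra_simps)
  have "\<exists>r > a. r = real (card (N 0) + (m - 4)) + real (m - 4) / (r - 1) + (\<Sum>v \<in> N 0. g r v)
      \<and> Q_index H = r"
  proof (rule Q_index_secular)
    have "continuous_on {a..} P" unfolding P_def by (intro continuous_intros)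
    moreover have "P q \<noteq> 0" if "a \<le> q" for q using P[of q] that a by auto
    ultimately show "continuous_on {a..} (\<lambda>q. g q i)" if "i < 4" for i
      using that unfolding less_4_iff g_def by (elim disjE) (auto intro!: continuous_intros)
    fix q assume q: "a \<le> q"
    define p where "p = P q"
    have p: "0 < p" "q^2 \<le> p" "q \<le> q^2" using P[of q] q a by (simp_all add: p_def)
    define x y z where "x = (q - 1)^2 / p" and "y = (q^2 - 3 * q + 1) / p" and "z = (q - 1) / p"
    have gq: "g q = (!) [1, x, y, z]" by (simp add: g_def p_def x_def y_def z_def)
    have "8 * q \<le> q^2" using q a by (simp add: power2_eq_square)
    then have y: "0 < x" "x \<le> 1" "0 < y" "y \<le> 1" "0 < z" "z \<le> 1"
      using q a p by (simp_all add: x_def y_def z_def divide_simps) (simp add: power2_eq_square algebra_simps)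
    have eq: "q * x = 3 * x + 1 + y + z" "q * y = 2 * y + 1 + x" "q * z = z + x"
      using p(1) by (simp_all add: x_def y_def z_def divide_simps)
        (simp_all add: p_def P_def power2_eq_square power3_eq_cube algebra_simps)
    show "0 < g q i \<and> g q i \<le> 1" if "i < 4" for i
      using that y unfolding less_4_iff gq by (elim disjE) auto
    show "real (card (N i)) * g q i + (\<Sum>v \<in> N i. g q v) = q * g q i" if "0 < i" "i < 4" for i
    proof -
      have "i = 1 \<or> i = 2 \<or> i = 3" using that by auto
      then show ?thesis by (elim disjE; simp only: N gq) (simp_all add: eq)
    qed
  qed (use a less in \<open>simp_all only: f\<close>, simp_all add: g_def)
  then show ?thesis unfolding f by (simp only: G_1_3_def)
qed

text \<open>The triangle gives \<open>1 / (q - 3)\<close> twice. On the path,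
  \<open>z = y / (q - 1)\<close> at vertex 4 and \<open>(q - 2) y = 1 + z\<close> at vertex 3 give
  \<open>y = (q - 1) / (q^2 - 3 q + 1)\<close>.\<close>

lemma Q_index_G_v_3:
  fixes m :: nat
  defines "f \<equiv> \<lambda>q. (real m - 2) + (real m - 5) / (q - 1) + 2 / (q - 3)
      + (q - 1) / (q^2 - 3 * q + 1)"
  assumes m: "5 \<le> m" and a: "8 \<le> a" and less: "a < f a"
  shows "\<exists>r > a. r = f r \<and> Q_index (G_v_3 m) = r"
proof -
  let ?K = "base_triangle \<union> {(0, 3), (3, 4)}"
  interpret star_extension ?K 5 m by (rule star_extension_G_v_3) fact
  define P where "P = (\<lambda>q :: real. q^2 - 3 * q + 1)"
  have P: "q \<le> P q" if "8 \<le> q" for q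
  proof -
    have "P q = q + (q * (q - 8) + 4 * q + 1)"
      by (simp add: P_def power2_eq_square algebra_simps)
    moreover have "0 \<le> q * (q - 8)" using that by simp
    ultimately show "q \<le> P q" using that by linarith
  qed
  define g where "g = (\<lambda>q :: real. (!) [1, 1 / (q - 3), 1 / (q - 3), (q - 1) / P q, 1 / P q])"
  have N: "N 0 = {1, 2, 3}" "N 1 = {0, 2}" "N 2 = {0, 1}" "N 3 = {0, 4}" "N 4 = {3}" by auto
  have f: "real (card (N 0) + (m - 5)) + real (m - 5) / (q - 1) + (\<Sum>v \<in> N 0. g q v) = f q" for q
    unfolding N using m by (simp add: g_def f_def of_nat_diff P_def)
  have "\<exists>r > a. r = real (card (N 0) + (m - 5)) + real (m - 5) / (r - 1) + (\<Sum>v \<in> N 0. g r v)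
      \<and> Q_index H = r"
  proof (rule Q_index_secular)
    have "continuous_on {a..} P" unfolding P_def by (intro continuous_intros)
    moreover have "P q \<noteq> 0" if "a \<le> q" for q using P[of q] that a by auto
    ultimately show "continuous_on {a..} (\<lambda>q. g q i)" if "i < 5" for i
      using that a unfolding less_5_iff g_def by (elim disjE) (auto intro!: continuous_intros)
    fix q assume q: "a \<le> q"
    define p where "p = P q"
    have p: "0 < p" "q \<le> p" using P[of q] q a by (simp_all add: p_def)
    define x y z where "x = 1 / (q - 3)" and "y = (q - 1) / p" and "z = 1 / p"
    have gq: "g q = (!) [1, x, x, y, z]" by (simp add: g_def p_def x_def y_def z_def)
    have y: "0 < x" "x \<le> 1" "0 < y" "y \<le> 1" "0 < z" "z \<le> 1"
      using q a p by (simp_all add: x_def y_def z_def divide_simps)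
    have eq: "q * x = 3 * x + 1" using q a by (simp add: x_def divide_simps)
    have eq': "q * y = 2 * y + 1 + z" "q * z = z + y"
      using p(1) by (simp_all add: y_def z_def divide_simps)
        (simp_all add: p_def P_def power2_eq_square algebra_simps)
    show "0 < g q i \<and> g q i \<le> 1" if "i < 5" for i
      using that y unfolding less_5_iff gq by (elim disjE) auto
    show "real (card (N i)) * g q i + (\<Sum>v \<in> N i. g q v) = q * g q i" if "0 < i" "i < 5" for i
    proof -
      have "i = 1 \<or> i = 2 \<or> i = 3 \<or> i = 4" using that by auto
      then show ?thesis by (elim disjE; simp only: N gq) (simp_all add: eq eq')
    qed
  qed (use a less in \<open>simp_all only: f\<close>, simp_all add: g_def)
  then show ?thesis unfolding f by (simp only: G_v_3_def)
qed

section \<open>Comparing consecutive secular functions\<close>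

lemma pos_frac_less_iff: "0 < b \<Longrightarrow> 0 < d \<Longrightarrow> a / b < c / d \<longleftrightarrow> a * d < c * b"
  for a b c d :: real
  by (simp add: field_simps)

text \<open>At \<open>q = m - 1\<close> this is \<open>q < f q\<close> for \<open>G_v_3 m\<close>,
  because there \<open>(m - 5) / (q - 1) + 3 / (q - 1) = 1\<close>. The inequality holds term by
  term after splitting 3 as 2 + 1.\<close>

lemma secular_base_less_G_v_3:
  fixes q :: real
  assumes q: "8 \<le> q"
  shows "3 / (q - 1) < 2 / (q - 3) + (q - 1) / (q^2 - 3 * q + 1)"
proof -
  define s where "s = q^2 - 3 * q + 1"
  have "s = q * (q - 3) + 1" by (simp add: s_def power2_eq_square algebra_simps)
  then have s: "0 < s" using q by (simp add: add_nonneg_pos)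
  have "(q - 1) * (q - 1) - s = q" by (simp add: s_def power2_eq_square algebra_simps)
  then have "1 / (q - 1) < (q - 1) / s" using q s by (subst pos_frac_less_iff) auto
  moreover have "2 / (q - 1) < 2 / (q - 3)" using q by (simp add: pos_frac_less_iff)
  ultimately have "2 / (q - 1) + 1 / (q - 1) < 2 / (q - 3) + (q - 1) / s" by linarith
  then show ?thesis by (simp add: s_def add_divide_distrib[symmetric])
qed

text \<open>What remains of comparing the two functions \<open>f\<close> once the common terms
  cancel; \<open>1 / (q - 1)\<close> is the extra pendant vertex at 0 in \<open>G_1_3 m\<close>. The
  cross-multiplied difference is a polynomial that is positive for \<open>q >= 8\<close>. The next
  three comparisons arise in the same way.\<close>

lemma secular_G_v_3_less_G_1_3:
  fixes q :: real
  assumes q: "8 \<le> q"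
  shows "2 / (q - 3) + (q - 1) / (q^2 - 3 * q + 1) <
    1 / (q - 1) + (2 * q^2 - 5 * q + 2) / (q^3 - 6 * q^2 + 9 * q - 3)"
proof -
  define s p where "s = q^2 - 3 * q + 1" and "p = q^3 - 6 * q^2 + 9 * q - 3"
  have "s = q * (q - 3) + 1" "p = q^2 * (q - 8) + 2 * q^2 + 9 * q - 3"
    by (simp_all add: s_def p_def power2_eq_square power3_eq_cube algebra_simps)
  moreover have "0 \<le> q * (q - 3)" "0 \<le> q^2 * (q - 8)" "0 \<le> q^2" using q by auto
  ultimately have pos: "0 < s" "0 < p" using q by linarith+
  have "2 / (q - 3) + (q - 1) / s = (2 * s + (q - 1) * (q - 3)) / ((q - 3) * s)"
    using q pos by (simp add: add_frac_eq)
  also have "\<dots> < (p + (2 * q^2 - 5 * q + 2) * (q - 1)) / ((q - 1) * p)"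
  proof -
    have "(p + (2 * q^2 - 5 * q + 2) * (q - 1)) * ((q - 3) * s) -
        (2 * s + (q - 1) * (q - 3)) * ((q - 1) * p) = q * (q^2 * (4 * q - 19) + 25 * q - 8)"
      unfolding s_def p_def power2_eq_square power3_eq_cube by (simp add: algebra_simps)
    moreover have "0 \<le> q^2 * (4 * q - 19)" using q by simp
    then have "0 < q * (q^2 * (4 * q - 19) + 25 * q - 8)" using q by (intro mult_pos_pos) linarith+
    ultimately show ?thesis using q pos by (subst pos_frac_less_iff) auto
  qed
  also have "\<dots> = 1 / (q - 1) + (2 * q^2 - 5 * q + 2) / p"
    using q pos by (simp add: add_frac_eq)
  finally show ?thesis by (simp add: s_def p_def)
qed

lemma secular_G_1_3_less_B_2:
  fixes q :: real
  assumes q: "8 \<le> q"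
  shows "2 / (q - 1) + (2 * q^2 - 5 * q + 2) / (q^3 - 6 * q^2 + 9 * q - 3) < 4 / (q - 3)"
proof -
  define p where "p = q^3 - 6 * q^2 + 9 * q - 3"
  have "p = q^2 * (q - 8) + 2 * q^2 + 9 * q - 3"
    by (simp add: p_def power2_eq_square power3_eq_cube algebra_simps)
  moreover have "0 \<le> q^2 * (q - 8)" "0 \<le> q^2" using q by auto
  ultimately have pos: "0 < p" using q by linarith
  have "2 / (q - 1) + (2 * q^2 - 5 * q + 2) / p = (2 * p + (2 * q^2 - 5 * q + 2) * (q - 1)) / ((q - 1) * p)"
    using q pos by (simp add: add_frac_eq)
  also have "\<dots> < 4 / (q - 3)"
  proof -
    have "4 * ((q - 1) * p) - (2 * p + (2 * q^2 - 5 * q + 2) * (q - 1)) * (q - 3) =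
        q^2 * (3 * q - 22) + 35 * q - 12"
      unfolding p_def power2_eq_square power3_eq_cube by (simp add: algebra_simps)
    moreover have "0 \<le> q^2 * (3 * q - 22)" using q by simp
    then have "0 < q^2 * (3 * q - 22) + 35 * q - 12" using q by linarith
    ultimately show ?thesis using q pos by (subst pos_frac_less_iff) auto
  qed
  finally show ?thesis by (simp add: p_def)
qed

lemma secular_B_2_less_B_1:
  fixes q :: real
  assumes q: "8 \<le> q"
  shows "4 / (q - 3) < 1 / (q - 1) + (3 * q - 4) / ((q - 1) * (q - 4))"
proof -
  have "1 / (q - 1) = (q - 4) / ((q - 1) * (q - 4))" using q by simp
  moreover have "(q - 4) + (3 * q - 4) = 4 * q - 8" by simp
  ultimately have "1 / (q - 1) + (3 * q - 4) / ((q - 1) * (q - 4)) = (4 * q - 8) / ((q - 1) * (q - 4))"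
    by (metis add_divide_distrib)
  \<comment> \<open>The numerators after cross-multiplication differ only by the constant 8.\<close>
  moreover have "(4 * q - 8) * (q - 3) - 4 * ((q - 1) * (q - 4)) = 8" by (simp add: algebra_simps)
  then have "4 / (q - 3) < (4 * q - 8) / ((q - 1) * (q - 4))"
    using q by (subst pos_frac_less_iff) auto
  ultimately show ?thesis by simp
qed

text \<open>In \<open>G_0_3 m\<close> the vertex 0 has degree larger by one, which is the summand 1
  and alone outweighs the left side.\<close>

lemma secular_B_1_less_G_0_3:
  fixes q :: real
  assumes q: "8 \<le> q"
  shows "(3 * q - 4) / ((q - 1) * (q - 4)) < 1 + 2 / (q - 1) + 2 / (q - 3)"
proof -
  have "(q - 1) * (q - 4) - (3 * q - 4) = q * (q - 8) + 8" by (simp add: algebra_simps)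
  moreover have "0 \<le> q * (q - 8)" using q by simp
  ultimately have "3 * q - 4 \<le> (q - 1) * (q - 4)" by linarith
  moreover have "0 < (q - 1) * (q - 4)" using q by simp
  ultimately have "(3 * q - 4) / ((q - 1) * (q - 4)) \<le> 1" by (simp add: divide_le_eq)
  moreover have "0 < 2 / (q - 1)" "0 < 2 / (q - 3)" using q by auto
  ultimately show ?thesis by linarith
qed

lemma Q_index_order:
  assumes m: "9 \<le> m"
  shows "real m - 1 < Q_index (G_v_3 m)" "Q_index (G_v_3 m) < Q_index (G_1_3 m)"
    "Q_index (G_1_3 m) < Q_index (B_2 m)" "Q_index (B_2 m) < Q_index (B_1 m)"
    "Q_index (B_1 m) < Q_index (G_0_3 m)"
proof -
  let ?fv = "\<lambda>q. (real m - 2) + (real m - 5) / (q - 1) + 2 / (q - 3) + (q - 1) / (q^2 - 3 * q + 1)"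
  let ?f1 = "\<lambda>q. (real m - 2) + (real m - 4) / (q - 1)
      + (2 * q^2 - 5 * q + 2) / (q^3 - 6 * q^2 + 9 * q - 3)"
  let ?f2 = "\<lambda>q. (real m - 2) + (real m - 6) / (q - 1) + 4 / (q - 3)"
  let ?fb = "\<lambda>q. (real m - 2) + (real m - 5) / (q - 1) + (3 * q - 4) / ((q - 1) * (q - 4))"
  let ?f0 = "\<lambda>q. (real m - 1) + (real m - 3) / (q - 1) + 2 / (q - 3)"
  \<comment> \<open>All pendant terms are brought to the smallest number of pendant vertices,
    \<open>m - 6\<close>, so that they cancel in each comparison.\<close>
  have split: "(real m - j) / (q - 1) = (real m - 6) / (q - 1) + (6 - j) / (q - 1)" for j q :: real
    by (simp add: add_divide_distrib[symmetric])
  have m8: "8 \<le> real m - 1" using m by simp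
  have "(real m - 2) / (real m - 1 - 1) = 1" using m by simp
  then have "(real m - 5) / (real m - 1 - 1) + 3 / (real m - 1 - 1) = 1"
    by (simp add: add_divide_distrib[symmetric])
  then have "real m - 1 < ?fv (real m - 1)"
    using secular_base_less_G_v_3[OF m8] by linarith
  then obtain rv where rv: "real m - 1 < rv" "rv = ?fv rv" "Q_index (G_v_3 m) = rv"
    using Q_index_G_v_3[of m "real m - 1"] m m8 by auto
  then have "8 \<le> rv" using m8 by linarith
  \<comment> \<open>At the root \<open>rv\<close> of one equation the next function already exceeds
    \<open>rv\<close>, so the next root lies beyond it; each further link of the chain repeats
    this.\<close>
  from secular_G_v_3_less_G_1_3[OF this] have "rv < ?f1 rv"
    using rv(2) split[of 5 rv] split[of 4 rv] add_divide_distrib[of 1 1 "rv - 1"] by auto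
  then obtain r1 where r1: "rv < r1" "r1 = ?f1 r1" "Q_index (G_1_3 m) = r1"
    using Q_index_G_1_3[of m rv] m \<open>8 \<le> rv\<close> by auto
  then have "8 \<le> r1" using \<open>8 \<le> rv\<close> by linarith
  from secular_G_1_3_less_B_2[OF this] have "r1 < ?f2 r1"
    using r1(2) split[of 4 r1] by auto
  then obtain r2 where r2: "r1 < r2" "r2 = ?f2 r2" "Q_index (B_2 m) = r2"
    using Q_index_B_2[of m r1] m \<open>8 \<le> r1\<close> by auto
  then have "8 \<le> r2" using \<open>8 \<le> r1\<close> by linarith
  from secular_B_2_less_B_1[OF this] have "r2 < ?fb r2"
    using r2(2) split[of 5 r2] by auto
  then obtain rb where rb: "r2 < rb" "rb = ?fb rb" "Q_index (B_1 m) = rb"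
    using Q_index_B_1[of m r2] m \<open>8 \<le> r2\<close> by auto
  then have "8 \<le> rb" using \<open>8 \<le> r2\<close> by linarith
  from secular_B_1_less_G_0_3[OF this] have "rb < ?f0 rb"
    using rb(2) split[of 5 rb] split[of 3 rb] add_divide_distrib[of 1 2 "rb - 1"] by auto
  then obtain r0 where r0: "rb < r0" "r0 = ?f0 r0" "Q_index (G_0_3 m) = r0"
    using Q_index_G_0_3[of m rb] m \<open>8 \<le> rb\<close> by auto
  show "real m - 1 < Q_index (G_v_3 m)" "Q_index (G_v_3 m) < Q_index (G_1_3 m)"
    "Q_index (G_1_3 m) < Q_index (B_2 m)" "Q_index (B_2 m) < Q_index (B_1 m)"
    "Q_index (B_1 m) < Q_index (G_0_3 m)"
    using rv r1 r2 rb r0 by simp_all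
qed

section \<open>Graphs with a vertex of large degree\<close>

text \<open>The list \<open>xs\<close> holds the images of the kernel vertices and \<open>P\<close>
  those of the pendant ones. As all pendant vertices hang at 0, any bijection onto \<open>P\<close>
  extends the kernel map to an isomorphism.\<close>

lemma (in star_extension) isomorphicI:
  assumes Field: "pverts G = Field (parcs G)"
    and xs: "distinct xs" "length xs = k"
    and P: "finite P" "card P = n - k" "set xs \<inter> P = {}"
    and arcs: "parcs G = S \<union> S\<inverse>"
    and S: "S = (\<lambda>(i, j). (xs ! i, xs ! j)) ` K \<union> {xs ! 0} \<times> P"
  shows "isomorphic G H"
proof -
  obtain h where h: "bij_betw h {k..<n} P"
    using finite_same_card_bij[of "{k..<n}" P] P by auto
  define f where "f = (\<lambda>i. if i < k then xs ! i else h i)"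
  have f0: "f 0 = xs ! 0" using k_pos by (simp add: f_def)
  have fK: "map_prod f f ` K = (\<lambda>(i, j). (xs ! i, xs ! j)) ` K"
    by (rule image_cong) (auto simp: f_def dest: K_less)
  have fP: "f ` {k..<n} = P" using h by (auto simp: f_def bij_betw_def)
  have S_eq: "map_prod f f ` (K \<union> {0} \<times> {k..<n}) = S"
    unfolding S image_Un fK by (simp add: map_prod_surj_on[OF refl refl] f0 fP)
  have conv: "map_prod f f ` (E\<inverse>) = (map_prod f f ` E)\<inverse>" for E by force
  have field: "Field (map_prod f f ` E) = f ` Field E" for E by (force simp: Field_def)
  have "map_prod f f ` parcs H = parcs G"
    unfolding arcs S_eq[symmetric] conv[symmetric] image_Un[symmetric] by (simp add: graph_of_def)
  moreover have "f ` pverts H = pverts G"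
    unfolding Field arcs S_eq[symmetric] Field_Un Field_converse field Un_absorb
    by (simp add: graph_of_def)
  moreover have inj: "inj_on f (pverts H)"
  proof -
    have "inj_on f {..<k}"
      using xs by (auto simp: f_def inj_on_def nth_eq_iff_index_eq)
    moreover have "inj_on f {k..<n}"
      using h by (auto simp: f_def bij_betw_def inj_on_def)
    moreover have "f ` {..<k} \<inter> f ` {k..<n} = {}"
    proof -
      have "f ` {..<k} \<subseteq> set xs" using xs by (auto simp: f_def)
      then show ?thesis using P(3) fP by auto
    qed
    moreover have "pverts H = {..<k} \<union> {k..<n}" using k_le_n by (auto simp: pverts_H)
    ultimately show ?thesis by (simp add: inj_on_Un) blast
  qed
  moreover have "inj_on (map_prod f f) (parcs H)"
    by (rule inj_on_subset[OF map_prod_inj_on[OF inj inj]])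
      (auto dest: graph_H.in_arcsD1 graph_H.in_arcsD2)
  \<comment> \<open>The map goes from \<open>H\<close> to \<open>G\<close>, so the isomorphism is
    reversed at the end.\<close>
  ultimately have "digraph_iso (with_proj H) (with_proj G)"
    unfolding digraph_iso_def pre_digraph.digraph_isomorphism_def
    by (intro exI[of _ "\<lparr>iso_verts = f, iso_arcs = map_prod f f, iso_head = snd, iso_tail = fst\<rparr>"])
      (auto simp: app_iso_def with_proj_def graph_H.wf_digraph[unfolded with_proj_def])
  then show ?thesis
    unfolding isomorphic_def by (rule digraph_iso_swap[OF graph_H.wf_digraph])
qed

text \<open>One or two edges avoid \<open>c\<close>, and one of them, \<open>ab\<close>, closes a
  triangle with \<open>c\<close>. If it is the only one, the graph is \<open>G_0_3 m\<close>.
  Otherwise the second edge is disjoint from \<open>ab\<close> (\<open>B_2 m\<close> or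
  \<open>G_v_3 m\<close>) or shares an end with it (\<open>B_1 m\<close> or \<open>G_1_3 m\<close>);
  in both cases the first graph arises if the remaining end is adjacent to \<open>c\<close>.\<close>

lemma isomorphic_if_degree_ge:
  assumes G: "G \<in> connected_graphs m 3" and c: "c \<in> pverts G"
    and deg: "m \<le> card (nbrs G c) + 2"
  shows "\<exists>H \<in> {G_0_3 m, B_1 m, B_2 m, G_1_3 m, G_v_3 m}. isomorphic G H"
proof -
  interpret pair_graph G using G by (simp add: connected_graphs_def)
  define N where "N = nbrs G c"
  define R where "R = {(u, v) \<in> parcs G. u \<noteq> c \<and> v \<noteq> c}"
  have symR: "(v, u) \<in> R" if "(u, v) \<in> R" for u v
    using that by (auto simp: R_def intro: arcs_symmetric)
  have irreflR: "u \<noteq> v" "u \<noteq> c" "v \<noteq> c" if "(u, v) \<in> R" for u v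
    using that no_loops' by (auto simp: R_def)
  have cN: "c \<notin> N" using no_loops' by (auto simp: N_def)
  have finN: "finite N" by (simp add: N_def finite_nbrs)
  have parcs: "parcs G = R \<union> {c} \<times> N \<union> N \<times> {c}"
    by (auto simp: R_def N_def intro: arcs_symmetric)
  have finR: "finite R" using pair_finite_arcs by (rule finite_subset[rotated]) (auto simp: R_def)
  have reach: "(u, v) \<in> (parcs G)\<^sup>*" if "u \<in> pverts G" "v \<in> pverts G" for u v
    using G that by (simp add: connected_graphs_def connected_iff)
  have "card (parcs G) = card R + card N + card N"
  proof -
    have "card (parcs G) = card (R \<union> {c} \<times> N) + card (N \<times> {c})"
      unfolding parcs using finR finN cN by (intro card_Un_disjoint) (auto simp: R_def)
    also have "card (R \<union> {c} \<times> N) = card R + card ({c} \<times> N)"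
      using finR finN by (intro card_Un_disjoint) (auto simp: R_def)
    finally show ?thesis by (simp add: card_cartesian_product)
  qed
  then have cardR: "card R + 2 * card N = 2 * m"
    using G by (simp add: card_parcs connected_graphs_def)
  then have cardR4: "card R \<le> 4" using deg by (simp add: N_def)
  obtain a b where ab: "(a, b) \<in> R" "a \<in> N" "b \<in> N"
  proof -
    obtain u v w where uvw: "(u, v) \<in> parcs G" "(v, w) \<in> parcs G" "(w, u) \<in> parcs G"
      using G by (auto simp: connected_graphs_def girth_eq_3_iff)
    \<comment> \<open>A triangle avoiding \<open>c\<close> would put six arcs into \<open>R\<close>,
      which has at most four.\<close>
    have "c \<in> {u, v, w}"
    proof (rule ccontr)
      let ?T = "{(u, v), (v, u), (v, w), (w, v), (w, u), (u, w)}"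
      assume "c \<notin> {u, v, w}"
      then have "?T \<subseteq> R" using uvw by (auto simp: R_def intro: arcs_symmetric)
      then have "card ?T \<le> 4" using card_mono[OF finR] cardR4 le_trans by blast
      moreover have "u \<noteq> v" "v \<noteq> w" "w \<noteq> u" using uvw no_loops' by auto
      ultimately show False by simp
    qed
    then consider "c = u" | "c = v" | "c = w" by blast
    then show thesis
    proof cases
      case 1
      with uvw show thesis
        by (intro that[of v w]) (auto simp: R_def N_def intro: arcs_symmetric dest: no_loops')
    next
      case 2
      with uvw show thesis
        by (intro that[of w u]) (auto simp: R_def N_def intro: arcs_symmetric dest: no_loops')
    next
      case 3
      with uvw show thesis
        by (intro that[of u v]) (auto simp: R_def N_def intro: arcs_symmetric dest: no_loops')
    qed
  qed
  have d: "a \<noteq> b" "a \<noteq> c" "b \<noteq> c" using irreflR[OF ab(1)] .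
  have Field: "pverts G = Field (parcs G)"
  proof
    show "pverts G \<subseteq> Field (parcs G)"
    proof
      fix u assume u: "u \<in> pverts G"
      show "u \<in> Field (parcs G)"
      proof (cases "u = c")
        case True
        then show ?thesis using ab by (auto simp: N_def Field_def)
      next
        case False
        then show ?thesis using reach[OF u c] by (auto simp: Field_def elim: converse_rtranclE)
      qed
    qed
    show "Field (parcs G) \<subseteq> pverts G"
      by (auto simp: Field_def dest: in_arcsD1 in_arcsD2)
  qed
  have abR: "{(a, b), (b, a)} \<subseteq> R" using ab symR by auto
  then have "card {(a, b), (b, a)} \<le> card R" by (rule card_mono[OF finR])
  then have "2 \<le> card R" using d by simp
  \<comment> \<open>By \<open>cardR\<close> the number of arcs in \<open>R\<close> is even.\<close>
  then have "card R = 2 \<or> card R = 4" using cardR cardR4 by presburger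
  then show ?thesis
  proof
    assume R2: "card R = 2"
    have "{(a, b), (b, a)} = R" by (rule card_subset_eq[OF finR abR]) (use R2 d in simp)
    then have R: "R = {(a, b), (b, a)}" by simp
    let ?P = "N - {a, b}"
    have "card N = m - 1" "1 \<le> m" using cardR R2 by auto
    then have P: "card ?P = m - 3" using ab d finN by (simp add: card_Diff_subset)
    have "2 \<le> card N" using card_mono[OF finN, of "{a, b}"] ab d by simp
    then have "3 \<le> m" using cardR R2 by simp
    then interpret S: star_extension base_triangle 3 m by (rule star_extension_G_0_3)
    have "isomorphic G S.H"
      by (rule S.isomorphicI[OF Field _ _ _ _ _ _ refl, where xs = "[c, a, b]" and P = ?P])
        (use d ab cN P finN in \<open>auto simp: parcs R\<close>)
    then show ?thesis by (simp add: G_0_3_def)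
  next
    assume R4: "card R = 4"
    then have cardN: "card N = m - 2" "2 \<le> m" using cardR by auto
    have "\<not> R \<subseteq> {(a, b), (b, a)}"
    proof
      assume "R \<subseteq> {(a, b), (b, a)}"
      then have "card R \<le> card {(a, b), (b, a)}" by (intro card_mono) auto
      then show False using R4 d by simp
    qed
    then obtain x' y' where xy': "(x', y') \<in> R" "(x', y') \<notin> {(a, b), (b, a)}" by auto
    have R': "R = {(a, b), (b, a), (x', y'), (y', x')}"
    proof (rule sym, rule card_subset_eq[OF finR])
      show "{(a, b), (b, a), (x', y'), (y', x')} \<subseteq> R" using abR xy' symR by auto
      show "card {(a, b), (b, a), (x', y'), (y', x')} = card R"
        using R4 xy' d irreflR[OF xy'(1)] by auto
    qed
    \<comment> \<open>Otherwise \<open>x'\<close> and \<open>y'\<close> would form a component of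
      their own, not containing \<open>c\<close>.\<close>
    have "x' \<in> N \<or> y' \<in> N"
    proof (rule ccontr)
      assume no: "\<not> (x' \<in> N \<or> y' \<in> N)"
      have "v \<in> {x', y'}" if "(x', v) \<in> (parcs G)\<^sup>*" for v
        using that
      proof (induction rule: rtrancl_induct)
        case (step v w)
        then show ?case using no ab irreflR[OF xy'(1)] by (auto simp: parcs R')
      qed simp
      moreover have "x' \<in> pverts G" using xy' in_arcsD1 by (auto simp: R_def)
      ultimately show False using reach[OF _ c] irreflR[OF xy'(1)] by blast
    qed
    then obtain x y where x: "x \<in> N" and xy: "(x, y) \<in> R" "(x, y) \<notin> {(a, b), (b, a)}"
      and R: "R = {(a, b), (b, a), (x, y), (y, x)}"
    proof
      assume "x' \<in> N"
      then show thesis using xy' R' by (rule that)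
    next
      assume "y' \<in> N"
      then show thesis using xy' R' symR by (intro that[of y' x']) auto
    qed
    have d': "x \<noteq> y" "x \<noteq> c" "y \<noteq> c" using irreflR[OF xy(1)] .
    show ?thesis
    proof (cases "{x, y} \<inter> {a, b} = {}")
      case True
      show ?thesis
      proof (cases "y \<in> N")
        case yN: True
        let ?P = "N - {a, b, x, y}"
        have P: "card ?P = m - 1 - 5" using ab x yN d d' True finN cardN
          by (simp add: card_Diff_subset)
        have "4 \<le> card N" using card_mono[OF finN, of "{a, b, x, y}"] ab x yN d d' True by simp
        then have "5 \<le> m - 1" using cardN by simp
        then interpret S: star_extension "base_triangle \<union> {(0, 3), (3, 4), (4, 0)}" 5 "m - 1"
          by (rule star_extension_B_2)
        have "isomorphic G S.H"
          by (rule S.isomorphicI[OF Field _ _ _ _ _ _ refl, where xs = "[c, a, b, x, y]" and P = ?P])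
            (use d d' ab x yN cN P finN True in \<open>auto simp: parcs R\<close>)
        then show ?thesis by (simp add: B_2_def)
      next
        case yN: False
        let ?P = "N - {a, b, x}"
        have P: "card ?P = m - 5" using ab x yN d d' True finN cardN
          by (simp add: card_Diff_subset)
        have "3 \<le> card N" using card_mono[OF finN, of "{a, b, x}"] ab x d d' True by simp
        then have "5 \<le> m" using cardN by simp
        then interpret S: star_extension "base_triangle \<union> {(0, 3), (3, 4)}" 5 m
          by (rule star_extension_G_v_3)
        have "isomorphic G S.H"
          by (rule S.isomorphicI[OF Field _ _ _ _ _ _ refl, where xs = "[c, a, b, x, y]" and P = ?P])
            (use d d' ab x yN cN P finN True in \<open>auto simp: parcs R\<close>)
        then show ?thesis by (simp add: G_v_3_def)
      qed
    next
      case False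
      \<comment> \<open>Renaming makes \<open>s\<close> the common end of the two edges, so that the
        four possible coincidences become one case.\<close>
      then obtain s t w where st: "s \<in> N" "t \<in> N" "s \<noteq> t" "s \<noteq> c" "t \<noteq> c"
        and w: "w \<noteq> s" "w \<noteq> t" "w \<noteq> c" and R: "R = {(s, t), (t, s), (s, w), (w, s)}"
      proof -
        consider "x = a" "y \<noteq> b" | "x = b" "y \<noteq> a" | "y = a" "x \<noteq> b" | "y = b" "x \<noteq> a"
          using False xy(2) by auto
        then show thesis
        proof cases
          case 1
          then show thesis using that[of a b y] ab d d' R by auto
        next
          case 2
          then show thesis using that[of b a y] ab d d' R by auto
        next
          case 3
          then show thesis using that[of a b x] ab d d' R by auto
        next
          case 4
          then show thesis using that[of b a x] ab d d' R by auto
        qed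
      qed
      show ?thesis
      proof (cases "w \<in> N")
        case wN: True
        let ?P = "N - {s, t, w}"
        have P: "card ?P = m - 1 - 4" using st w wN finN cardN
          by (simp add: card_Diff_subset)
        have "3 \<le> card N" using card_mono[OF finN, of "{s, t, w}"] st w wN by simp
        then have "4 \<le> m - 1" using cardN by simp
        then interpret S: star_extension "base_triangle \<union> {(1, 3), (3, 0)}" 4 "m - 1"
          by (rule star_extension_B_1)
        have "isomorphic G S.H"
          by (rule S.isomorphicI[OF Field _ _ _ _ _ _ refl, where xs = "[c, s, t, w]" and P = ?P])
            (use st w wN cN P finN in \<open>auto simp: parcs R\<close>)
        then show ?thesis by (simp add: B_1_def)
      next
        case wN: False
        let ?P = "N - {s, t}"
        have P: "card ?P = m - 4" using st finN cardN
          by (simp add: card_Diff_subset)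
        have "2 \<le> card N" using card_mono[OF finN, of "{s, t}"] st by simp
        then have "4 \<le> m" using cardN by simp
        then interpret S: star_extension "base_triangle \<union> {(1, 3)}" 4 m
          by (rule star_extension_G_1_3)
        have "isomorphic G S.H"
          by (rule S.isomorphicI[OF Field _ _ _ _ _ _ refl, where xs = "[c, s, t, w]" and P = ?P])
            (use st w wN cN P finN in \<open>auto simp: parcs R\<close>)
        then show ?thesis by (simp add: G_1_3_def)
      qed
    qed
  qed
qed

section \<open>The largest \<open>Q\<close>-indices\<close>

theorem theorem1p3:
  fixes m :: nat
  assumes "m \<ge> 9"
  shows "{G_0_3 m, B_1 m, B_2 m, G_1_3 m, G_v_3 m} \<subseteq> connected_graphs m 3 \<and>
    Q_index (G_0_3 m) > Q_index (B_1 m) \<and>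
    Q_index (B_1 m) > Q_index (B_2 m) \<and>
    Q_index (B_2 m) > Q_index (G_1_3 m) \<and>
    Q_index (G_1_3 m) > Q_index (G_v_3 m) \<and>
    (\<forall>G :: 'a pair_pre_digraph. G \<in> connected_graphs m 3 \<longrightarrow>
           (\<forall>H \<in> {G_0_3 m, B_1 m, B_2 m, G_1_3 m, G_v_3 m}. \<not> isomorphic G H) \<longrightarrow>
           Q_index G < Q_index (G_v_3 m))"
proof (intro conjI allI impI)
  show "{G_0_3 m, B_1 m, B_2 m, G_1_3 m, G_v_3 m} \<subseteq> connected_graphs m 3"
    using assms by (simp add: G_0_3_in_connected_graphs B_1_in_connected_graphs
        B_2_in_connected_graphs G_1_3_in_connected_graphs G_v_3_in_connected_graphs)
next
  fix G :: "'a pair_pre_digraph"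
  assume G: "G \<in> connected_graphs m 3"
    and not_iso: "\<forall>H \<in> {G_0_3 m, B_1 m, B_2 m, G_1_3 m, G_v_3 m}. \<not> isomorphic G H"
  interpret pair_graph G using G by (simp add: connected_graphs_def)
  have m: "card (edges G) = m" using G by (simp add: connected_graphs_def)
  have ne: "pverts G \<noteq> {}" and reach: "\<And>u v. u \<in> pverts G \<Longrightarrow> v \<in> pverts G \<Longrightarrow> (u, v) \<in> (parcs G)\<^sup>*"
    using G by (auto simp: connected_graphs_def connected_iff)
  \<comment> \<open>An isolated vertex would be the only vertex of the connected graph, which then
    had no edges.\<close>
  have "nbrs G u \<noteq> {}" if u: "u \<in> pverts G" for u
  proof
    assume "nbrs G u = {}"
    then have "v = u" if "v \<in> pverts G" for v
      using reach[OF u that] by (auto elim: converse_rtranclE)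
    then have "parcs G = {}" using in_arcsD1 in_arcsD2 no_loops' by (metis equals0I surj_pair)
    then show False using m assms by (simp add: edges_def)
  qed
  moreover have "card (nbrs G u) + 3 \<le> m" if "u \<in> pverts G" for u
    using isomorphic_if_degree_ge[OF G that] not_iso by (cases "m \<le> card (nbrs G u) + 2") auto
  ultimately have "Q_index G \<le> real m - 1"
    using Q_index_le_if_degree_le ne m assms by simp
  also have "\<dots> < Q_index (G_v_3 m)" by (rule Q_index_order(1)) fact
  finally show "Q_index G < Q_index (G_v_3 m)" .
qed (use Q_index_order[OF assms] in simp_all)

end
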